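(* Let $g^{(0)}:V\to\mathbb{C}$ be a normalized signal (i.e. $\|g^{(0)}\|_2=1$) and let $f:V\to\mathbb{R}$ be a feature location. Let $g^{(t)}=\mathcal{S}[t,f]g^{(0)}$ for every $t\in\mathbb{R}$, where $\mathcal{S}[t,f]=e^{-it\Delta_f}$ and $\Delta_f=-\nabla_f^2$. Then $$\frac{\partial}{\partial t}\mathcal{E}_{X_f}(g^{(t)})=2\,\mathrm{Re}\left(\langle i\nabla_f g^{(t)},W_f g^{(t)}\rangle\right).$$
   Context: $\mathcal{G}=(V,E)$ is a finite undirected weighted graph with $V=[N]=\{1,\dots,N\}$, $E\subset[N]^2$, and real symmetric adjacency matrix $A=(a_{n,m})\in\mathbb{R}^{N\times N}$ with $a_{n,m}=0$ whenever $n,m$ are not joined by an edge; $\mathcal{N}(v)$ is the neighborhood of $v$. Signals $g:V\to\mathbb{C}$ are identified with vectors in $\mathbb{C}^N$, with $\langle u,g\rangle=\sum_{v\in V}u(v)\overline{g(v)}$ and $\|g\|_2^2=\langle g,g\rangle$. A feature location is a function $f:V\to\mathbb{R}$. The $f$-partial derivative is the matrix $\nabla_f\in\mathbb{C}^{N\times N}$ with entries $(\nabla_f)_{n,m}=a_{n,m}(f(n)-f(m))$. The feature location observable is $X_f=\mathrm{diag}(f)$. The $f$-smoothing operator $W_f:\mathbb{C}^N\to\mathbb{C}^N$ is $(W_fg)(v)=\sum_{w\in\mathcal{N}(v)}a_{v,w}(f(w)-f(v))^2g(w)$. For a self-adjoint operator $M$ on $\mathbb{C}^N$ and a normalized signal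 $g$, the expected value is $\mathcal{E}_M(g)=\langle Mg,g\rangle$. *)

theory Defs
  imports "HOL-Analysis.Analysis"
begin

(* The vertex set is a finite type 'n, and signals V -> C are vectors of type complex^'n.
   Self-loops are allowed; they play no role below, since f(n) - f(n) = 0. *)
definition weighted_graph :: "('n::finite \<times> 'n) set \<Rightarrow> real^'n^'n \<Rightarrow> bool" where
  "weighted_graph E A \<longleftrightarrow>
     sym E \<and> transpose A = A \<and> (\<forall>n m. (n, m) \<notin> E \<longrightarrow> A $ n $ m = 0)"

definition neighborhood :: "('n \<times> 'n) set \<Rightarrow> 'n \<Rightarrow> 'n set" where
  "neighborhood E v = {w. (v, w) \<in> E}"

(* Antilinear in the second argument. The library's inner product on complex^'n is only the
   real part of this; the library norm on complex^'n is the associated 2-norm, see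
   signal_inner_self. *)
definition signal_inner :: "complex^'n \<Rightarrow> complex^'n \<Rightarrow> complex" where
  "signal_inner u g = (\<Sum>v\<in>UNIV. u $ v * cnj (g $ v))"

lemma signal_inner_self:
  fixes g :: "complex^'n"
  shows "signal_inner g g = complex_of_real ((norm g)\<^sup>2)"
proof -
  have "signal_inner g g = complex_of_real (\<Sum>v\<in>UNIV. (norm (g $ v))\<^sup>2)"
    unfolding signal_inner_def of_real_sum
    by (intro sum.cong refl) (metis complex_norm_square)
  also have "(\<Sum>v\<in>UNIV. (norm (g $ v))\<^sup>2) = (norm g)\<^sup>2"
    unfolding norm_vec_def L2_set_def by (simp add: sum_nonneg)
  finally show ?thesis .
qed

(* Multiplication and powers written with * and ^ are componentwise on the type
   complex^'n^'n, so matrix powers are built from **. *)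
definition matrix_pow :: "complex^'n^'n \<Rightarrow> nat \<Rightarrow> complex^'n^'n" where
  "matrix_pow M k = (((**) M) ^^ k) (mat 1)"

definition matrix_scale :: "complex \<Rightarrow> complex^'n^'n \<Rightarrow> complex^'n^'n" where
  "matrix_scale c M = (\<chi> n m. c * M $ n $ m)"

definition matrix_exp :: "complex^'n^'n \<Rightarrow> complex^'n^'n" where
  "matrix_exp M = (\<Sum>k. matrix_pow M k /\<^sub>R fact k)"

lemma summable_matrix_exp:
  fixes M :: "complex^'n^'n"
  shows "summable (\<lambda>k. matrix_pow M k /\<^sub>R fact k)"
proof -
  obtain K where K: "K > 0" "\<And>B::complex^'n^'n. norm (M ** B) \<le> norm B * K"
  proof -
    have "linear (\<lambda>B::complex^'n^'n. M ** B)"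
      by (rule linearI)
        (simp_all add: vec_eq_iff matrix_matrix_mult_def scaleR_sum_right distrib_left sum.distrib)
    then have "bounded_linear (\<lambda>B::complex^'n^'n. M ** B)"
      by (rule linear_conv_bounded_linear[THEN iffD1])
    from bounded_linear.pos_bounded[OF this] that show thesis by blast
  qed
  have bound: "norm (matrix_pow M k) \<le> norm (mat 1 :: complex^'n^'n) * K ^ k" for k
  proof (induction k)
    case (Suc k)
    have "norm (matrix_pow M (Suc k)) \<le> norm (matrix_pow M k) * K"
      using K(2)[of "matrix_pow M k"] by (simp add: matrix_pow_def)
    also have "\<dots> \<le> norm (mat 1 :: complex^'n^'n) * K ^ k * K"
      using Suc K(1) by (intro mult_right_mono) auto
    finally show ?case by (simp add: mult_ac)
  qed (simp add: matrix_pow_def)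
  show ?thesis
  proof (rule summable_comparison_test)
    show "summable (\<lambda>k. norm (mat 1 :: complex^'n^'n) * (inverse (fact k) * K ^ k))"
      by (intro summable_mult summable_exp)
    show "\<exists>N. \<forall>k\<ge>N. norm (matrix_pow M k /\<^sub>R fact k)
            \<le> norm (mat 1 :: complex^'n^'n) * (inverse (fact k) * K ^ k)"
      using bound by (auto simp: divide_simps mult_ac)
  qed
qed

definition partial_deriv :: "real^'n^'n \<Rightarrow> ('n \<Rightarrow> real) \<Rightarrow> complex^'n^'n" where
  "partial_deriv A f = (\<chi> n m. complex_of_real (A $ n $ m * (f n - f m)))"

definition laplacian :: "real^'n^'n \<Rightarrow> ('n \<Rightarrow> real) \<Rightarrow> complex^'n^'n" where
  "laplacian A f = - (partial_deriv A f ** partial_deriv A f)"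

definition shift_op :: "real^'n^'n \<Rightarrow> real \<Rightarrow> ('n \<Rightarrow> real) \<Rightarrow> complex^'n^'n" where
  "shift_op A t f = matrix_exp (matrix_scale (- \<i> * complex_of_real t) (laplacian A f))"

definition location_observable :: "('n \<Rightarrow> real) \<Rightarrow> complex^'n^'n" where
  "location_observable f = (\<chi> n m. if n = m then complex_of_real (f n) else 0)"

definition smoothing_op ::
  "('n \<times> 'n) set \<Rightarrow> real^'n^'n \<Rightarrow> ('n \<Rightarrow> real) \<Rightarrow> complex^'n \<Rightarrow> complex^'n" where
  "smoothing_op E A f g =
     (\<chi> v. \<Sum>w\<in>neighborhood E v. complex_of_real (A $ v $ w * (f w - f v)\<^sup>2) * g $ w)"

definition expected_value :: "complex^'n^'n \<Rightarrow> complex^'n \<Rightarrow> complex" where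
  "expected_value M g = signal_inner (M *v g) g"

end

theory Submission
  imports Defs
begin

text \<open>
  Write \<open>P\<close> for the partial derivative, \<open>X\<close> for the location observable and \<open>W\<close> for the
  smoothing operator. The flow satisfies \<open>g' = i P P g\<close>, and \<open>X\<close> is self-adjoint, so the expected
  value has derivative \<open>2 Re \<langle>i P P g, X g\<rangle>\<close>. Since \<open>P\<close> is skew-adjoint and \<open>P X = X P - W\<close>,
  this equals \<open>2 Re (\<langle>i P g, W g\<rangle> - \<langle>i P g, X P g\<rangle>)\<close>, and \<open>\<langle>P g, X P g\<rangle>\<close> is real.
\<close>

lemma matrix_pow_scaleR: "matrix_pow (t *\<^sub>R B) k = t ^ k *\<^sub>R matrix_pow B k"
proof (induction k)
  case (Suc k)
  then have "matrix_pow (t *\<^sub>R B) (Suc k) = (t *\<^sub>R B) ** (t ^ k *\<^sub>R matrix_pow B k)"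
    by (simp add: matrix_pow_def)
  also have "\<dots> = t ^ Suc k *\<^sub>R matrix_pow B (Suc k)"
    by (simp add: matrix_pow_def matrix_matrix_mult_def vec_eq_iff scaleR_sum_right mult.commute)
  finally show ?case .
qed (simp add: matrix_pow_def)

text \<open>Each entry of \<open>matrix_exp (t *\<^sub>R B)\<close> is a scalar power series with
  complex coefficients, evaluated at the real point \<open>t\<close>. This reduces differentiating
  the exponential to termwise differentiation of scalar series.\<close>

lemma matrix_exp_nth_sums:
  "(\<lambda>k. matrix_pow B k $ n $ m / fact k * complex_of_real t ^ k) sums (matrix_exp (t *\<^sub>R B) $ n $ m)"
proof -
  have "(\<lambda>k. matrix_pow (t *\<^sub>R B) k /\<^sub>R fact k) sums matrix_exp (t *\<^sub>R B)"
    unfolding matrix_exp_def by (rule summable_sums[OF summable_matrix_exp])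
  then have "(\<lambda>k. (matrix_pow (t *\<^sub>R B) k /\<^sub>R fact k) $ n $ m) sums (matrix_exp (t *\<^sub>R B) $ n $ m)"
    by (intro bounded_linear.sums[OF bounded_linear_vec_nth])
  then show ?thesis
    by (simp add: matrix_pow_scaleR scaleR_conv_of_real[where 'a = complex] divide_inverse mult_ac)
qed

lemma matrix_exp_nth_has_vector_derivative:
  fixes B :: "complex^'n^'n"
  shows "((\<lambda>s. matrix_exp (s *\<^sub>R B) $ n $ m) has_vector_derivative
           (B ** matrix_exp (t *\<^sub>R B)) $ n $ m) (at t)"
proof -
  define c where "c k = matrix_pow B k $ n $ m / fact k" for k
  have c_sums: "(\<lambda>k. c k * complex_of_real s ^ k) sums (matrix_exp (s *\<^sub>R B) $ n $ m)" for s
    unfolding c_def by (rule matrix_exp_nth_sums)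
  \<comment> \<open>Convergence is so far known only at real points. The real point
    \<open>norm z + 1\<close> has modulus larger than \<open>norm z\<close>, so the series converges
    at every complex \<open>z\<close>.\<close>
  have c_summable: "summable (\<lambda>k. c k * z ^ k)" for z :: complex
    using c_sums[of "norm z + 1", THEN sums_summable]
    by (rule powser_inside) simp
  \<comment> \<open>The factor \<open>Suc k\<close> in \<open>diffs\<close> turns
    \<open>fact (Suc k)\<close> into \<open>fact k\<close>, and the extra matrix power splits off as
    a left factor \<open>B\<close>; keeping \<open>of_nat (Suc k)\<close> folded allows the
    cancellation.\<close>
  have "(\<lambda>k. diffs c k * complex_of_real t ^ k) =
      (\<lambda>k. \<Sum>j\<in>UNIV. B $ n $ j * (matrix_pow B k $ j $ m / fact k * complex_of_real t ^ k))"
    by (simp add: diffs_def c_def matrix_pow_def matrix_matrix_mult_def sum_distrib_right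
        sum_distrib_left sum_divide_distrib mult_ac fun_eq_iff del: of_nat_Suc)
  also have "\<dots> sums (\<Sum>j\<in>UNIV. B $ n $ j * matrix_exp (t *\<^sub>R B) $ j $ m)"
    by (intro sums_sum sums_mult matrix_exp_nth_sums)
  finally have "(\<Sum>k. diffs c k * complex_of_real t ^ k) = (B ** matrix_exp (t *\<^sub>R B)) $ n $ m"
    by (simp add: sums_iff matrix_matrix_mult_def)
  with termdiffs_strong_converges_everywhere[OF c_summable, of "complex_of_real t"]
  have "((\<lambda>z. \<Sum>k. c k * z ^ k) has_field_derivative (B ** matrix_exp (t *\<^sub>R B)) $ n $ m)
      (at (complex_of_real t))"
    by simp
  \<comment> \<open>The complex derivative is restricted to the real axis.\<close>
  then have "((\<lambda>s. \<Sum>k. c k * complex_of_real s ^ k) has_vector_derivative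
      (B ** matrix_exp (t *\<^sub>R B)) $ n $ m) (at t)"
    by (rule has_vector_derivative_real_field)
  then show ?thesis
    using c_sums by (simp add: sums_iff)
qed

lemma matrix_exp_mult_vec_nth_has_vector_derivative:
  fixes B :: "complex^'n^'n"
  shows "((\<lambda>s. (matrix_exp (s *\<^sub>R B) *v x) $ n) has_vector_derivative
           (B *v (matrix_exp (t *\<^sub>R B) *v x)) $ n) (at t)"
  unfolding matrix_vector_mul_assoc
  unfolding matrix_vector_mult_def
  by (simp, intro has_vector_derivative_sum has_vector_derivative_mult_left
      matrix_exp_nth_has_vector_derivative)

text \<open>The two minus signs, from the exponent and from the Laplacian, cancel. Pulling out the
  real parameter \<open>t\<close> exhibits a one-parameter group with fixed generator i P P.\<close>

lemma shift_op_conv_matrix_exp: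
  "shift_op A t f =
     matrix_exp (t *\<^sub>R matrix_scale \<i> (partial_deriv A f ** partial_deriv A f))"
proof -
  have "matrix_scale (- \<i> * complex_of_real t) (laplacian A f) =
      t *\<^sub>R matrix_scale \<i> (partial_deriv A f ** partial_deriv A f)"
    by (simp add: matrix_scale_def laplacian_def vec_eq_iff scaleR_conv_of_real[where 'a = complex])
  then show ?thesis
    by (simp add: shift_op_def)
qed

lemma matrix_scale_mult_vec: "matrix_scale c M *v x = c *s (M *v x)"
  by (simp add: matrix_scale_def matrix_vector_mult_def vec_eq_iff sum_distrib_left mult_ac)

lemma location_observable_mult_vec:
  "location_observable f *v x = (\<chi> v. complex_of_real (f v) * x $ v)"
  by (simp add: location_observable_def matrix_vector_mult_def vec_eq_iff if_distrib[of "\<lambda>z. z * _"]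
      cong: if_cong)

text \<open>The matrix is real, and it is antisymmetric because \<open>A\<close> is symmetric while
  \<open>f v - f j\<close> changes sign under exchange of \<open>v\<close> and
  \<open>j\<close>.\<close>

lemma signal_inner_partial_deriv:
  assumes "weighted_graph E A"
  shows "signal_inner (partial_deriv A f *v u) w = - signal_inner u (partial_deriv A f *v w)"
proof -
  have sym: "A $ v $ j = A $ j $ v" for v j
  proof -
    have "A $ v $ j = transpose A $ v $ j"
      using assms by (simp add: weighted_graph_def)
    then show ?thesis
      by (simp add: transpose_def)
  qed
  have "signal_inner (partial_deriv A f *v u) w =
      (\<Sum>v\<in>UNIV. \<Sum>j\<in>UNIV. complex_of_real (A $ v $ j * (f v - f j)) * u $ j * cnj (w $ v))"
    by (simp add: signal_inner_def partial_deriv_def matrix_vector_mult_def sum_distrib_right)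
  also have "\<dots> =
      (\<Sum>j\<in>UNIV. \<Sum>v\<in>UNIV. complex_of_real (A $ v $ j * (f v - f j)) * u $ j * cnj (w $ v))"
    by (rule sum.swap)
  also have "\<dots> =
      (\<Sum>j\<in>UNIV. \<Sum>v\<in>UNIV. - (u $ j * (complex_of_real (A $ j $ v * (f j - f v)) * cnj (w $ v))))"
    by (intro sum.cong refl) (simp add: sym algebra_simps)
  also have "\<dots> = - signal_inner u (partial_deriv A f *v w)"
    by (simp add: signal_inner_def partial_deriv_def matrix_vector_mult_def sum_distrib_left
        sum_negf)
  finally show ?thesis .
qed

text \<open>Entrywise, the commutator P X - X P multiplies \<open>A $ v $ w * (f v - f w)\<close> by
  \<open>f w - f v\<close>, which produces the negated square in the smoothing operator.\<close>

lemma partial_deriv_location_observable: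
  assumes "weighted_graph E A"
  shows "partial_deriv A f *v (location_observable f *v x) =
           location_observable f *v (partial_deriv A f *v x) - smoothing_op E A f x"
proof -
  \<comment> \<open>The sum over neighbors extends to all vertices, since \<open>A\<close> vanishes
    off the edges.\<close>
  have "smoothing_op E A f x =
      (\<chi> v. \<Sum>w\<in>UNIV. complex_of_real (A $ v $ w * (f w - f v)\<^sup>2) * x $ w)"
    unfolding smoothing_op_def
  proof (intro vec_lambda_unique[THEN iffD1] allI, unfold vec_lambda_beta, rule sum.mono_neutral_right)
    fix v
    show "\<forall>w\<in>UNIV - neighborhood E v. complex_of_real (A $ v $ w * (f w - f v)\<^sup>2) * x $ w = 0"
      using assms by (simp add: weighted_graph_def neighborhood_def)
  qed auto
  then show ?thesis
    unfolding location_observable_mult_vec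
    by (simp add: partial_deriv_def matrix_vector_mult_def vec_eq_iff sum_distrib_left
        sum_subtractf[symmetric])
      (simp add: algebra_simps power2_eq_square)
qed

lemma signal_inner_diff_right: "signal_inner u (w - x) = signal_inner u w - signal_inner u x"
  by (simp add: signal_inner_def algebra_simps sum_subtractf)

lemma signal_inner_scale_left: "signal_inner (c *s u) w = c * signal_inner u w"
  by (simp add: signal_inner_def sum_distrib_left mult_ac)

text \<open>Every summand is \<open>f v\<close> times the squared modulus of
  \<open>h $ v\<close>.\<close>

lemma Im_signal_inner_location_observable: "Im (signal_inner h (location_observable f *v h)) = 0"
  by (simp add: signal_inner_def location_observable_mult_vec)

text \<open>The product rule gives, at each vertex, a number plus its conjugate, hence twice a real
  part; the weight \<open>f v\<close> is real.\<close>

lemma expected_value_has_vector_derivative: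
  assumes "\<And>v. ((\<lambda>s. g s $ v) has_vector_derivative g' $ v) (at t)"
  shows "((\<lambda>s. expected_value (location_observable f) (g s)) has_vector_derivative
           complex_of_real (2 * Re (signal_inner g' (location_observable f *v g t)))) (at t)"
proof -
  have "((\<lambda>s. \<Sum>v\<in>UNIV. complex_of_real (f v) * (g s $ v * cnj (g s $ v)))
      has_vector_derivative
      (\<Sum>v\<in>UNIV. complex_of_real (f v) * (g t $ v * cnj (g' $ v) + g' $ v * cnj (g t $ v)))) (at t)"
    by (intro has_vector_derivative_sum has_vector_derivative_mult_right has_vector_derivative_mult
        has_vector_derivative_cnj assms)
  also have "(\<Sum>v\<in>UNIV. complex_of_real (f v) * (g t $ v * cnj (g' $ v) + g' $ v * cnj (g t $ v))) =
      complex_of_real (2 * Re (signal_inner g' (location_observable f *v g t)))"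
    by (simp add: complex_eq_iff signal_inner_def location_observable_mult_vec sum_distrib_left
        algebra_simps)
  finally show ?thesis
    by (simp add: expected_value_def signal_inner_def location_observable_mult_vec mult_ac)
qed

theorem theorem7:
  fixes E :: "('n::finite \<times> 'n) set"
    and A :: "real^'n^'n"
    and f :: "'n \<Rightarrow> real"
    and g0 :: "complex^'n"
    and g :: "real \<Rightarrow> complex^'n"
  assumes "weighted_graph E A"
    and "norm g0 = 1"
    and "\<And>t. g t = shift_op A t f *v g0"
  shows "\<forall>t. ((\<lambda>s. expected_value (location_observable f) (g s)) has_vector_derivative
           complex_of_real
             (2 * Re (signal_inner (\<i> *s (partial_deriv A f *v g t)) (smoothing_op E A f (g t)))))
           (at t)"
proof
  fix t
  let ?P = "partial_deriv A f" and ?X = "location_observable f" and ?W = "smoothing_op E A f"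
  let ?h = "?P *v g t"
  have "((\<lambda>s. g s $ v) has_vector_derivative (\<i> *s (?P *v ?h)) $ v) (at t)" for v
    using matrix_exp_mult_vec_nth_has_vector_derivative[of "matrix_scale \<i> (?P ** ?P)" g0 v t]
    by (simp only: assms(3) shift_op_conv_matrix_exp matrix_scale_mult_vec
        matrix_vector_mul_assoc[symmetric])
  then have "((\<lambda>s. expected_value ?X (g s)) has_vector_derivative
      complex_of_real (2 * Re (signal_inner (\<i> *s (?P *v ?h)) (?X *v g t)))) (at t)"
    by (rule expected_value_has_vector_derivative)
  \<comment> \<open>One P moves to the right argument with a sign change, then is commuted past
    X.\<close>
  also have "signal_inner (\<i> *s (?P *v ?h)) (?X *v g t) =
      \<i> * signal_inner ?h (?W (g t)) - \<i> * signal_inner ?h (?X *v ?h)"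
    by (simp add: signal_inner_scale_left signal_inner_partial_deriv[OF assms(1)]
        partial_deriv_location_observable[OF assms(1)] signal_inner_diff_right algebra_simps)
  also have "Re \<dots> = Re (signal_inner (\<i> *s ?h) (?W (g t)))"
    by (simp add: signal_inner_scale_left Im_signal_inner_location_observable)
  finally show "((\<lambda>s. expected_value ?X (g s)) has_vector_derivative
      complex_of_real (2 * Re (signal_inner (\<i> *s ?h) (?W (g t))))) (at t)" .
qed

end
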